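(* Let $S$ be an associative algebra over $\mathbb{K}$ with $S[S,S]=0$ and $[S,S]S^3=0$. Then the Lie algebra $(S[t],\langle-,-\rangle)$ satisfies $\mathrm{St}_5$.
   Context: $\mathbb{K}$ is a field of characteristic zero. $[x,y]=xy-yx$ in $S$; $S[S,S]=0$ means $x(yz-zy)=0$ for all $x,y,z\in S$, and $[S,S]S^3=0$ means $(xy-yx)z_1z_2z_3=0$ for all $x,y,z_1,z_2,z_3\in S$. $S[t]$ is the algebra of polynomials in the (central) indeterminate $t$ with coefficients in $S$, $a'=\frac{d}{dt}a$, and $\langle a,b\rangle:=b'a-a'b$, which is a Lie bracket on $S[t]$ when $S[S,S]=0$. For a Lie algebra with bracket $[-,-]$, $$\mathrm{St}_{n+1}(x_1,\dots,x_n,z):=\sum_{\sigma}(-1)^{\sigma}[x_{\sigma(1)},[x_{\sigma(2)},[\cdots,[x_{\sigma(n)},z]\cdots]]],$$ where $\sigma$ runs over the symmetric group of degree $n$ and $(-1)^\sigma$ is the sign of $\sigma$. The Lie algebra satisfies $\mathrm{St}_{n+1}$ if this expression vanishes for all $x_1,\dots,x_n,z$ in it. *)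

theory Defs
  imports
    "HOL.Vector_Spaces"
    "HOL-Library.Poly_Mapping"
    "HOL-Combinatorics.Permutations"
begin

(* The class ring is associative, but neither commutative nor unital; S[S,S] = 0 would force
   a unital algebra to be commutative. *)
locale assoc_algebra = vector_space scale
  for scale :: "'k::field \<Rightarrow> 'a::ring \<Rightarrow> 'a" +
  assumes scale_mult_left: "scale c x * y = scale c (x * y)"
    and scale_mult_right: "x * scale c y = scale c (x * y)"

locale lie_algebra = vector_space scale
  for scale :: "'k::field \<Rightarrow> 'v::ab_group_add \<Rightarrow> 'v"
    and bracket :: "'v \<Rightarrow> 'v \<Rightarrow> 'v" +
  assumes bracket_add_left: "bracket (x + y) z = bracket x z + bracket y z"
    and bracket_add_right: "bracket x (y + z) = bracket x y + bracket x z"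
    and bracket_scale_left: "bracket (scale c x) y = scale c (bracket x y)"
    and bracket_scale_right: "bracket x (scale c y) = scale c (bracket x y)"
    and bracket_self: "bracket x x = 0"
    and jacobi: "bracket x (bracket y z) + bracket y (bracket z x) + bracket z (bracket x y) = 0"

(* St_m (x_1, ..., x_(m-1), z), so that St_(n+1) involves the permutations of {1..n}. *)
definition lie_St ::
  "('k::field \<Rightarrow> 'v::ab_group_add \<Rightarrow> 'v) \<Rightarrow> ('v \<Rightarrow> 'v \<Rightarrow> 'v) \<Rightarrow> nat \<Rightarrow> (nat \<Rightarrow> 'v) \<Rightarrow> 'v \<Rightarrow> 'v"
  where "lie_St scale bracket m x z =
    (\<Sum>\<sigma> | \<sigma> permutes {1..<m}.
      scale (of_int (sign \<sigma>)) (foldr (\<lambda>i. bracket (x (\<sigma> i))) [1..<m] z))"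

definition satisfies_lie_St ::
  "('k::field \<Rightarrow> 'v::ab_group_add \<Rightarrow> 'v) \<Rightarrow> ('v \<Rightarrow> 'v \<Rightarrow> 'v) \<Rightarrow> nat \<Rightarrow> bool"
  where "satisfies_lie_St scale bracket m \<longleftrightarrow> (\<forall>x z. lie_St scale bracket m x z = 0)"

(* S[t] is the type nat \<Rightarrow>\<^sub>0 'a with its convolution product (t is central); the type 'a poly has a
   product only for commutative coefficients. *)

definition poly_scale :: "('k \<Rightarrow> 'a \<Rightarrow> 'a) \<Rightarrow> 'k \<Rightarrow> (nat \<Rightarrow>\<^sub>0 'a) \<Rightarrow> (nat \<Rightarrow>\<^sub>0 'a::zero)"
  where "poly_scale scale c p = Poly_Mapping.map (scale c) p"

(* The term for n = 0 vanishes since it is multiplied by 0. *)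
definition poly_deriv ::
  "('k::field \<Rightarrow> 'a \<Rightarrow> 'a) \<Rightarrow> (nat \<Rightarrow>\<^sub>0 'a) \<Rightarrow> (nat \<Rightarrow>\<^sub>0 'a::comm_monoid_add)"
  where "poly_deriv scale p =
    (\<Sum>n\<in>Poly_Mapping.keys p.
      Poly_Mapping.single (n - 1) (scale (of_nat n) (Poly_Mapping.lookup p n)))"

definition poly_bracket ::
  "('k::field \<Rightarrow> 'a \<Rightarrow> 'a) \<Rightarrow> (nat \<Rightarrow>\<^sub>0 'a) \<Rightarrow> (nat \<Rightarrow>\<^sub>0 'a) \<Rightarrow> (nat \<Rightarrow>\<^sub>0 'a::ring)"
  where "poly_bracket scale a b = poly_deriv scale b * a - poly_deriv scale a * b"

lemma poly_mapping_add_induct [case_names zero single add]: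
  fixes p :: "'b \<Rightarrow>\<^sub>0 'a::monoid_add"
  assumes "P 0" and s: "\<And>n x. P (Poly_Mapping.single n x)"
    and a: "\<And>p q. P p \<Longrightarrow> P q \<Longrightarrow> P (p + q)"
  shows "P p"
proof (induction p rule: update_induct)
  case const
  show ?case by fact
next
  case (update f k b)
  have "Poly_Mapping.update k b f = f + Poly_Mapping.single k b"
    using update(1) by (intro poly_mapping_eqI)
      (auto simp: lookup_update lookup_add lookup_single when_def in_keys_iff)
  then show ?case using a update(3) s by simp
qed

context assoc_algebra
begin

lemma lookup_poly_scale: "Poly_Mapping.lookup (poly_scale scale c p) n = scale c (Poly_Mapping.lookup p n)"
  unfolding poly_scale_def by (simp add: Poly_Mapping.map.rep_eq when_def)

lemma lookup_poly_deriv: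
  "Poly_Mapping.lookup (poly_deriv scale p) n
    = scale (of_nat (Suc n)) (Poly_Mapping.lookup p (Suc n))"
proof -
  have "Poly_Mapping.lookup (poly_deriv scale p) n
      = (\<Sum>m\<in>Poly_Mapping.keys p. if m = Suc n
          then scale (of_nat (Suc n)) (Poly_Mapping.lookup p (Suc n)) else 0)"
    unfolding poly_deriv_def lookup_sum
  proof (intro sum.cong refl)
    fix m
    show "Poly_Mapping.lookup (Poly_Mapping.single (m - 1)
          (scale (of_nat m) (Poly_Mapping.lookup p m))) n
        = (if m = Suc n then scale (of_nat (Suc n)) (Poly_Mapping.lookup p (Suc n)) else 0)"
      by (cases m) (auto simp: lookup_single when_def)
  qed
  also have "\<dots> = scale (of_nat (Suc n)) (Poly_Mapping.lookup p (Suc n))"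
    by (auto simp: in_keys_iff)
  finally show ?thesis .
qed

lemma poly_deriv_add: "poly_deriv scale (p + q) = poly_deriv scale p + poly_deriv scale q"
  by (intro poly_mapping_eqI) (simp only: lookup_poly_deriv lookup_add scale_right_distrib)

lemma poly_deriv_diff: "poly_deriv scale (p - q) = poly_deriv scale p - poly_deriv scale q"
  by (intro poly_mapping_eqI) (simp only: lookup_poly_deriv lookup_minus scale_right_diff_distrib)

lemma poly_deriv_scale: "poly_deriv scale (poly_scale scale c p) = poly_scale scale c (poly_deriv scale p)"
  by (intro poly_mapping_eqI) (simp only: lookup_poly_deriv lookup_poly_scale scale_left_commute)

lemma poly_deriv_single:
  "poly_deriv scale (Poly_Mapping.single n x) = Poly_Mapping.single (n - 1) (scale (of_nat n) x)"
  by (simp add: poly_deriv_def)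

lemma poly_scale_single:
  "poly_scale scale c (Poly_Mapping.single n x) = Poly_Mapping.single n (scale c x)"
  by (intro poly_mapping_eqI) (auto simp: lookup_poly_scale lookup_single when_def)

lemma poly_scale_add: "poly_scale scale c (p + q) = poly_scale scale c p + poly_scale scale c q"
  by (intro poly_mapping_eqI) (simp only: lookup_poly_scale lookup_add scale_right_distrib)

lemma poly_scale_zero: "poly_scale scale c 0 = 0"
  by (intro poly_mapping_eqI) (simp add: lookup_poly_scale)

lemma poly_deriv_zero: "poly_deriv scale 0 = 0"
  by (simp add: poly_deriv_def)

lemma poly_deriv_mult:
  "poly_deriv scale (p * q) = poly_deriv scale p * q + p * poly_deriv scale q"
proof (induction p rule: poly_mapping_add_induct)
  case (single m x)
  show ?case
  proof (induction q rule: poly_mapping_add_induct)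
    case (single n y)
    show ?case
    proof (cases "m = 0 \<or> n = 0")
      case True
      then show ?thesis
        by (auto simp: poly_deriv_single mult_single scale_mult_left scale_mult_right)
    next
      case False
      then have "n - Suc 0 + m = m + n - Suc 0" "m - Suc 0 + n = m + n - Suc 0"
        "m + (n - Suc 0) = m + n - Suc 0"
        by auto
      then show ?thesis
        by (simp add: poly_deriv_single mult_single scale_mult_left scale_mult_right
            scale_left_distrib single_add)
    qed
  qed (simp_all add: poly_deriv_zero poly_deriv_add algebra_simps)
qed (simp_all add: poly_deriv_zero poly_deriv_add algebra_simps)

lemma assoc_algebra_poly: "assoc_algebra (poly_scale scale)"
proof
  fix c :: 'k and p q :: "nat \<Rightarrow>\<^sub>0 'a"
  show "poly_scale scale c p * q = poly_scale scale c (p * q)"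
  proof (induction p rule: poly_mapping_add_induct)
    case (single m x)
    show ?case
      by (induction q rule: poly_mapping_add_induct)
        (simp_all add: poly_scale_zero poly_scale_single poly_scale_add mult_single
          scale_mult_left distrib_left)
  qed (simp_all add: poly_scale_zero poly_scale_add distrib_right)
  show "p * poly_scale scale c q = poly_scale scale c (p * q)"
  proof (induction p rule: poly_mapping_add_induct)
    case (single m x)
    show ?case
      by (induction q rule: poly_mapping_add_induct)
        (simp_all add: poly_scale_zero poly_scale_single poly_scale_add mult_single
          scale_mult_right distrib_left)
  qed (simp_all add: poly_scale_zero poly_scale_add distrib_right)
qed (intro poly_mapping_eqI; simp add: lookup_poly_scale lookup_add scale_left_distrib
      scale_right_distrib)+

lemma poly_right_commute:
  fixes p q r :: "nat \<Rightarrow>\<^sub>0 'a"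
  assumes "\<And>x y z :: 'a. x * (y * z - z * y) = 0"
  shows "p * (q * r) = p * (r * q)"
proof (induction p rule: poly_mapping_add_induct)
  case (single l x)
  show ?case
  proof (induction q rule: poly_mapping_add_induct)
    case (single m y)
    show ?case
    proof (induction r rule: poly_mapping_add_induct)
      case (single n z)
      have "x * (y * z) = x * (z * y)"
        using assms[of x y z] by (simp add: right_diff_distrib)
      then show ?case by (simp add: mult_single ac_simps)
    qed (simp_all add: distrib_left distrib_right)
  qed (simp_all add: distrib_left distrib_right)
qed (simp_all add: distrib_right)

lemma lie_algebra_poly_bracket:
  assumes "\<And>x y z :: 'a. x * (y * z - z * y) = 0"
  shows "lie_algebra (poly_scale scale) (poly_bracket scale)"
proof -
  interpret poly: assoc_algebra "poly_scale scale"
    by (rule assoc_algebra_poly)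
  show ?thesis
  proof
    fix c :: 'k and p q r :: "nat \<Rightarrow>\<^sub>0 'a"
    show "poly_bracket scale (p + q) r = poly_bracket scale p r + poly_bracket scale q r"
      and "poly_bracket scale p (q + r) = poly_bracket scale p q + poly_bracket scale p r"
      by (simp_all add: poly_bracket_def poly_deriv_add algebra_simps)
    show "poly_bracket scale (poly_scale scale c p) q = poly_scale scale c (poly_bracket scale p q)"
      and "poly_bracket scale p (poly_scale scale c q) = poly_scale scale c (poly_bracket scale p q)"
      by (simp_all add: poly_bracket_def poly_deriv_scale poly.scale_mult_left
          poly.scale_mult_right poly.scale_right_diff_distrib)
    show "poly_bracket scale p p = 0"
      by (simp add: poly_bracket_def)
    show "poly_bracket scale p (poly_bracket scale q r) + poly_bracket scale q (poly_bracket scale r p)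
        + poly_bracket scale r (poly_bracket scale p q) = 0"
      by (simp add: poly_bracket_def poly_deriv_diff poly_deriv_mult algebra_simps
          poly_right_commute[OF assms])
  qed
qed

end

end

theory Submission
  imports Defs
begin

text \<open>A product of at least five elements of \<open>S[t]\<close> does not depend on the order of its factors:
  \<open>S[S,S] = 0\<close> permutes all factors but the first, and \<open>[S,S]S\<^sup>3 = 0\<close> exchanges the first
  two (\<open>nonempty_prod_cong_mset\<close>).  The iterated bracket
  \<open>\<langle>x\<^sub>1, \<langle>x\<^sub>2, \<langle>x\<^sub>3, \<langle>x\<^sub>4, z\<rangle>\<rangle>\<rangle>\<rangle>\<close> has degree five, so after expansion it behaves as
  over commutative coefficients.

  By the Leibniz rule it is a sum of signed monomials, each a product of one derivative of each of
  \<open>x\<^sub>1, \<dots>, x\<^sub>4, z\<close>, and the orders of these derivatives add up to 4, one for each bracket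
  (\<open>multilinear_diff_poly_iterated_bracket\<close>).  Four distinct orders would add up to at least
  \<open>0 + 1 + 2 + 3 = 6\<close>, so in each monomial two of the \<open>x\<^sub>i\<close> occur with the same order.
  Exchanging these two fixes the monomial up to the order of its factors but reverses the sign of
  the permutation, so the alternating sum of each monomial vanishes
  (\<open>alternating_sum_diff_poly_eq_0\<close>).

  The same count works for every \<open>n \<ge> 4\<close> in place of 4, and for every ring with a derivation whose
  products of \<open>n + 1\<close> elements do not depend on the order of the factors and whose additive group
  is a vector space in characteristic zero; this is \<open>satisfies_lie_St_bracket\<close>.\<close>


section \<open>Products of nonempty lists in a ring without unit\<close>

fun nonempty_prod :: "'a::semigroup_mult list \<Rightarrow> 'a" where
  "nonempty_prod (a # xs) = foldl (*) a xs"

lemma nonempty_prod_snoc: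
  "xs \<noteq> [] \<Longrightarrow> nonempty_prod (xs @ [a]) = nonempty_prod xs * a"
  by (cases xs) auto

lemma nonempty_prod_Cons:
  assumes "xs \<noteq> []"
  shows "nonempty_prod (a # xs) = a * nonempty_prod xs"
proof -
  have "foldl (*) (a * b) ys = a * foldl (*) b ys" for b ys
    by (induction ys arbitrary: b) (simp_all add: mult.assoc)
  with assms show ?thesis
    by (cases xs) simp_all
qed

text \<open>The first assumption, right commutativity, lets all factors but the first move freely.  The
  second assumption exchanges the first two factors once three more follow, so that the first
  place loses its special role.\<close>

lemma nonempty_prod_cong_mset:
  fixes xs ys :: "'a::semigroup_mult list"
  assumes right: "\<And>x y z :: 'a. x * (y * z) = x * (z * y)"
    and first: "\<And>x y z1 z2 z3 :: 'a. x * y * z1 * z2 * z3 = y * x * z1 * z2 * z3"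
    and mset: "mset xs = mset ys" and len: "5 \<le> length xs"
  shows "nonempty_prod xs = nonempty_prod ys"
proof -
  have tail: "nonempty_prod (c # us) = nonempty_prod (c # vs)" if "mset us = mset vs" for c :: 'a and us vs
  proof -
    have "fold (\<lambda>x a. a * x) us = fold (\<lambda>x a. a * x) vs"
      using that by (intro fold_multiset_equiv) (auto simp: fun_eq_iff mult.assoc intro: right)
    then show ?thesis
      by (simp add: foldl_conv_fold)
  qed
  have head: "nonempty_prod (c # d # us) = nonempty_prod (d # c # us)" if "3 \<le> length us" for c d :: 'a and us
  proof -
    obtain z1 z2 z3 vs where "us = z1 # z2 # z3 # vs"
      using \<open>3 \<le> length us\<close> by (auto simp: numeral_3_eq_3 Suc_le_length_iff)
    then show ?thesis
      using first[of c d z1 z2 z3] by simp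
  qed
  obtain c us where xs: "xs = c # us"
    using len by (cases xs) auto
  obtain d vs where ys: "ys = d # vs"
    using len mset by (cases ys) auto
  show ?thesis
  proof (cases "c = d")
    case True
    then have "mset us = mset vs"
      using mset xs ys by simp
    then show ?thesis
      unfolding xs ys True by (rule tail)
  next
    case False
    then have "d \<in># mset us"
      using mset xs ys by (metis insert_noteq_member mset.simps(2))
    then obtain ws where ws: "mset us = mset (d # ws)"
      by (metis ex_mset insert_DiffM mset.simps(2))
    then have vs: "mset (c # ws) = mset vs"
      using mset xs ys by (simp add: add_mset_commute)
    have "length us = Suc (length ws)"
      using arg_cong[OF ws, of size] by simp
    then have "3 \<le> length ws"
      using len xs by simp
    then show ?thesis
      unfolding xs ys using tail[OF ws, of c] head[of ws c d] tail[OF vs, of d] by metis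
  qed
qed


section \<open>Multilinear differential polynomials\<close>

locale ring_derivation =
  fixes D :: "'a::ring \<Rightarrow> 'a"
  assumes D_add: "D (x + y) = D x + D y"
    and D_mult: "D (x * y) = D x * y + x * D y"
begin

lemma D_diff: "D (x - y) = D x - D y"
  using D_add[of "x - y" y] by (simp add: algebra_simps)

definition bracket :: "'a \<Rightarrow> 'a \<Rightarrow> 'a" where
  "bracket a b = D b * a - D a * b"

text \<open>A word is a nonempty list of letters \<open>(i, e)\<close>, where \<open>(i, e)\<close> stands for the derivative of
  order \<open>e\<close> of the variable with index \<open>i\<close>.\<close>

definition word_value :: "('i \<Rightarrow> 'a) \<Rightarrow> ('i \<times> nat) list \<Rightarrow> 'a" where
  "word_value v w = nonempty_prod (map (\<lambda>(i, e). (D ^^ e) (v i)) w)"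

lemma word_value_snoc:
  "w \<noteq> [] \<Longrightarrow> word_value v (w @ [(i, e)]) = word_value v w * (D ^^ e) (v i)"
  by (simp add: word_value_def nonempty_prod_snoc)

lemma word_value_Cons:
  "w \<noteq> [] \<Longrightarrow> word_value v ((i, e) # w) = (D ^^ e) (v i) * word_value v w"
  using nonempty_prod_Cons[of "map (\<lambda>(i, e). (D ^^ e) (v i)) w"] by (simp add: word_value_def)

text \<open>The polynomials are functions of the assignment of values to the variables, since the
  alternating sum later varies this assignment while the words remain the same.\<close>

inductive multilinear_diff_poly ::
  "'i set \<Rightarrow> nat \<Rightarrow> (('i \<Rightarrow> 'a) \<Rightarrow> 'a) \<Rightarrow> bool" for A n where
  word: "\<lbrakk>w \<noteq> []; distinct (map fst w); fst ` set w = A; sum_list (map snd w) = n\<rbrakk>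
    \<Longrightarrow> multilinear_diff_poly A n (\<lambda>v. word_value v w)"
| add: "\<lbrakk>multilinear_diff_poly A n f; multilinear_diff_poly A n g\<rbrakk>
    \<Longrightarrow> multilinear_diff_poly A n (\<lambda>v. f v + g v)"
| diff: "\<lbrakk>multilinear_diff_poly A n f; multilinear_diff_poly A n g\<rbrakk>
    \<Longrightarrow> multilinear_diff_poly A n (\<lambda>v. f v - g v)"

lemma multilinear_diff_poly_mult_right:
  assumes "multilinear_diff_poly A n f" "i \<notin> A"
  shows "multilinear_diff_poly (insert i A) (n + e) (\<lambda>v. f v * (D ^^ e) (v i))"
  using assms(1)
proof induction
  case (word w)
  have "multilinear_diff_poly (insert i A) (n + e) (\<lambda>v. word_value v (w @ [(i, e)]))"
    using word assms(2) by (intro multilinear_diff_poly.word) auto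
  then show ?case
    using word by (simp add: word_value_snoc)
qed (simp_all add: distrib_right left_diff_distrib multilinear_diff_poly.add
      multilinear_diff_poly.diff)

lemma multilinear_diff_poly_mult_left:
  assumes "multilinear_diff_poly A n f" "i \<notin> A"
  shows "multilinear_diff_poly (insert i A) (n + e) (\<lambda>v. (D ^^ e) (v i) * f v)"
  using assms(1)
proof induction
  case (word w)
  have "multilinear_diff_poly (insert i A) (n + e) (\<lambda>v. word_value v ((i, e) # w))"
    using word assms(2) by (intro multilinear_diff_poly.word) auto
  then show ?case
    using word by (simp add: word_value_Cons)
qed (simp_all add: distrib_left right_diff_distrib multilinear_diff_poly.add
      multilinear_diff_poly.diff)

lemma multilinear_diff_poly_D_word:
  assumes "w \<noteq> []" "distinct (map fst w)"
  shows "multilinear_diff_poly (fst ` set w) (Suc (sum_list (map snd w))) (\<lambda>v. D (word_value v w))"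
  using assms
proof (induction w rule: rev_induct)
  case Nil
  then show ?case by simp
next
  case (snoc l w)
  obtain i e where l: "l = (i, e)" by fastforce
  show ?case
  proof (cases "w = []")
    case True
    have "multilinear_diff_poly {i} (Suc e) (\<lambda>v. word_value v [(i, Suc e)])"
      by (intro multilinear_diff_poly.word) auto
    then show ?thesis
      using True l by (simp add: word_value_def)
  next
    case False
    let ?A = "fst ` set w" and ?n = "sum_list (map snd w)"
    have i: "i \<notin> ?A" and dist: "distinct (map fst w)"
      using snoc.prems l by auto
    have "multilinear_diff_poly (insert i ?A) (Suc ?n + e) (\<lambda>v. D (word_value v w) * (D ^^ e) (v i))"
      by (rule multilinear_diff_poly_mult_right[OF snoc.IH[OF False dist] i])
    moreover have "multilinear_diff_poly (insert i ?A) (?n + Suc e)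
        (\<lambda>v. word_value v w * (D ^^ Suc e) (v i))"
      using False dist by (intro multilinear_diff_poly_mult_right i multilinear_diff_poly.word) auto
    ultimately show ?thesis
      using multilinear_diff_poly.add False l
      by (fastforce simp: word_value_snoc D_mult)
  qed
qed

lemma multilinear_diff_poly_D:
  assumes "multilinear_diff_poly A n f"
  shows "multilinear_diff_poly A (Suc n) (\<lambda>v. D (f v))"
  using assms
proof induction
  case (word w)
  then show ?case
    using multilinear_diff_poly_D_word[of w] by simp
qed (simp_all add: D_add D_diff multilinear_diff_poly.add multilinear_diff_poly.diff)

text \<open>Each bracket brings in one new variable and one derivative, so the total order of the
  iterated bracket is the number of brackets.\<close>

lemma multilinear_diff_poly_bracket:
  assumes f: "multilinear_diff_poly A n f" and i: "i \<notin> A"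
  shows "multilinear_diff_poly (insert i A) (Suc n) (\<lambda>v. bracket (v i) (f v))"
proof -
  have "multilinear_diff_poly (insert i A) (Suc n + 0) (\<lambda>v. D (f v) * (D ^^ 0) (v i))"
    by (intro multilinear_diff_poly_mult_right multilinear_diff_poly_D f i)
  moreover have "multilinear_diff_poly (insert i A) (n + 1) (\<lambda>v. (D ^^ 1) (v i) * f v)"
    by (intro multilinear_diff_poly_mult_left f i)
  ultimately show ?thesis
    unfolding bracket_def using multilinear_diff_poly.diff by fastforce
qed

lemma multilinear_diff_poly_iterated_bracket:
  assumes "distinct is" "j \<notin> set is"
  shows "multilinear_diff_poly (insert j (set is)) (length is)
    (\<lambda>v. foldr (\<lambda>i. bracket (v i)) is (v j))"
  using assms
proof (induction "is")
  case Nil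
  have "multilinear_diff_poly {j} 0 (\<lambda>v. word_value v [(j, 0)])"
    by (intro multilinear_diff_poly.word) auto
  then show ?case
    by (simp add: word_value_def)
next
  case (Cons i "is")
  then have "multilinear_diff_poly (insert i (insert j (set is))) (Suc (length is))
      (\<lambda>v. bracket (v i) (foldr (\<lambda>i. bracket (v i)) is (v j)))"
    by (intro multilinear_diff_poly_bracket) auto
  then show ?case
    by (simp add: insert_commute)
qed

end


section \<open>Alternating sums\<close>

text \<open>Composition with the transposition permutes the summands and reverses all signs, so the sum
  equals its negative and vanishes away from characteristic two.\<close>

lemma (in vector_space) alternating_sum_eq_0:
  fixes f :: "('i \<Rightarrow> 'i) \<Rightarrow> 'b"
  assumes char: "(2 :: 'a) \<noteq> 0"
    and S: "finite S" "i \<in> S" "j \<in> S" "i \<noteq> j"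
    and f: "\<And>\<sigma>. \<sigma> permutes S \<Longrightarrow> f (\<sigma> \<circ> transpose i j) = f \<sigma>"
  shows "(\<Sum>\<sigma> | \<sigma> permutes S. scale (of_int (sign \<sigma>)) (f \<sigma>)) = 0" (is "?s = 0")
proof -
  have "?s = (\<Sum>\<sigma> | \<sigma> permutes S.
      scale (of_int (sign (\<sigma> \<circ> transpose i j))) (f (\<sigma> \<circ> transpose i j)))"
    by (rule sum_permutations_compose_right) (simp add: S permutes_swap_id)
  also have "\<dots> = (\<Sum>\<sigma> | \<sigma> permutes S. - scale (of_int (sign \<sigma>)) (f \<sigma>))"
  proof (rule sum.cong[OF refl])
    fix \<sigma> assume "\<sigma> \<in> {\<sigma>. \<sigma> permutes S}"
    then have \<sigma>: "\<sigma> permutes S" by simp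
    then have "sign (\<sigma> \<circ> transpose i j) = - sign \<sigma>"
      using S by (simp add: sign_compose permutation_swap_id sign_swap_id
          permutes_imp_permutation[OF S(1)])
    then show "scale (of_int (sign (\<sigma> \<circ> transpose i j))) (f (\<sigma> \<circ> transpose i j))
        = - scale (of_int (sign \<sigma>)) (f \<sigma>)"
      by (simp add: f[OF \<sigma>])
  qed
  also have "\<dots> = - ?s"
    by (simp add: sum_negf)
  finally have "?s + ?s = 0"
    using add.right_inverse by metis
  then have "scale 2 ?s = 0"
    using scale_left_distrib[of 1 1 ?s] by simp
  then show ?thesis
    using char by simp
qed

lemma sum_lessThan_card_le:
  fixes S :: "nat set"
  assumes "finite S"
  shows "\<Sum>{..<card S} \<le> \<Sum>S"
  using assms
proof (induction S rule: finite_linorder_max_induct)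
  case (insert m S)
  then have "S \<subseteq> {..<m}" by auto
  then have "card S \<le> m"
    using card_mono[of "{..<m}" S] by simp
  moreover have "m \<notin> S"
    using insert by auto
  ultimately show ?case
    using insert by simp
qed simp

text \<open>Distinct orders of \<open>n\<close> variables add up to at least \<open>n * (n - 1) / 2\<close>, which exceeds \<open>n\<close>
  for \<open>n \<ge> 4\<close>.\<close>

lemma two_equal_orders:
  fixes e :: "'i \<Rightarrow> nat"
  assumes "finite A" "4 \<le> card A" "sum e A \<le> card A"
  obtains i j where "i \<in> A" "j \<in> A" "i \<noteq> j" "e i = e j"
proof (cases "inj_on e A")
  case True
  have large: "n < \<Sum>{..<n}" if "4 \<le> n" for n :: nat
    using that
    using that
  proof (induction n rule: dec_induct)
    case base
    have "{..<4} = {0, 1, 2, 3 :: nat}" by auto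
    then show ?case by simp
  qed (simp add: lessThan_Suc)
  have "\<Sum>{..<card A} \<le> sum e A"
    using sum_lessThan_card_le[of "e ` A"] True assms(1) by (simp add: card_image sum.reindex)
  then show ?thesis
    using large[of "card A"] assms by simp
next
  case False
  then show ?thesis
    using that by (auto simp: inj_on_def)
qed

context ring_derivation
begin

text \<open>The indices in the word are distinct, so the transposition of \<open>i\<close> and \<open>j\<close> moves only the
  letters \<open>(i, e)\<close> and \<open>(j, e)\<close>, and it exchanges them because their orders agree.\<close>

lemma word_value_transpose:
  assumes comm: "\<And>xs ys :: 'a list. mset xs = mset ys \<Longrightarrow> length xs = length w
      \<Longrightarrow> nonempty_prod xs = nonempty_prod ys"
    and dist: "distinct (map fst w)" and ij: "(i, e) \<in> set w" "(j, e) \<in> set w"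
  shows "word_value (v \<circ> transpose i j) w = word_value v w"
proof -
  let ?\<tau> = "map_prod (transpose i j) id :: _ \<times> nat \<Rightarrow> _"
  have inv: "?\<tau> (?\<tau> l) = l" for l
    by (cases l) simp
  have closed: "?\<tau> l \<in> set w" if "l \<in> set w" for l
  proof (cases "fst l = i \<or> fst l = j")
    case True
    then have "l = (i, e) \<or> l = (j, e)"
      using that ij dist by (metis eq_key_imp_eq_value prod.collapse)
    then show ?thesis
      using ij by auto
  next
    case False
    then have "?\<tau> l = l"
      by (cases l) (simp add: transpose_def)
    then show ?thesis
      using that by simp
  qed
  have "set (map ?\<tau> w) = set w"
  proof
    show "set w \<subseteq> set (map ?\<tau> w)"
    proof
      fix l assume "l \<in> set w"
      then have "?\<tau> (?\<tau> l) \<in> set (map ?\<tau> w)"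
        unfolding set_map by (intro imageI closed)
      then show "l \<in> set (map ?\<tau> w)"
        by (simp only: inv)
    qed
  qed (use closed in auto)
  moreover have "distinct w"
    using dist by (simp add: distinct_map)
  moreover have "distinct (map ?\<tau> w)"
    using \<open>distinct w\<close> inv by (metis distinct_map inj_on_inverseI)
  ultimately have mset: "mset (map ?\<tau> w) = mset w"
    using set_eq_iff_mset_eq_distinct by blast
  let ?letter = "\<lambda>(i, e). (D ^^ e) (v i)"
  have "word_value (v \<circ> transpose i j) w = nonempty_prod (map ?letter (map ?\<tau> w))"
    by (simp add: word_value_def case_prod_unfold comp_def)
  also have "\<dots> = nonempty_prod (map ?letter w)"
    using mset by (intro comm) (metis mset_map, simp)
  finally show ?thesis
    by (simp add: word_value_def)
qed

text \<open>Here \<open>z\<close> is the index of the one variable that is not permuted.  It shares the total order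
  \<open>card A\<close> with the variables from \<open>A\<close>, so these have orders of sum at most \<open>card A\<close>.\<close>

lemma alternating_sum_diff_poly_eq_0:
  fixes scale :: "'k::field_char_0 \<Rightarrow> 'a \<Rightarrow> 'a" and A :: "'i set"
  assumes "vector_space scale"
    and comm: "\<And>xs ys :: 'a list. mset xs = mset ys \<Longrightarrow> length xs = Suc (card A)
      \<Longrightarrow> nonempty_prod xs = nonempty_prod ys"
    and A: "finite A" "4 \<le> card A" "z \<notin> A"
    and f: "multilinear_diff_poly (insert z A) (card A) f"
  shows "(\<Sum>\<sigma> | \<sigma> permutes A. scale (of_int (sign \<sigma>)) (f (v \<circ> \<sigma>))) = 0"
proof -
  interpret vector_space scale
    by (rule assms(1))
  show ?thesis
    using f
  proof induction
    case (word w)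
    define e where "e i = the (map_of w i)" for i
    have e: "(i, e i) \<in> set w" if "i \<in> insert z A" for i
    proof -
      have "i \<in> fst ` set w"
        using that word(3) by blast
      then have "map_of w i \<noteq> None"
        by (simp add: map_of_eq_None_iff)
      then show ?thesis
        unfolding e_def by (auto dest: map_of_SomeD)
    qed
    have inj: "inj_on fst (set w)" and "distinct w"
      using word(2) by (simp_all add: distinct_map)
    have "card A = sum_list (map snd w)"
      by (rule word(4)[symmetric])
    also have "\<dots> = sum snd (set w)"
      using \<open>distinct w\<close> by (rule sum_list_distinct_conv_sum_set)
    also have "\<dots> = sum (\<lambda>l. e (fst l)) (set w)"
      using word(2) by (intro sum.cong) (auto simp: e_def)
    also have "\<dots> = sum e (fst ` set w)"
      using inj by (simp add: sum.reindex)
    also have "\<dots> = e z + sum e A"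
      unfolding word(3) using A by simp
    \<comment> \<open>The order of the letter with index \<open>z\<close> is dropped.\<close>
    finally have "sum e A \<le> card A"
      by simp
    then obtain i j where ij: "i \<in> A" "j \<in> A" "i \<noteq> j" "e i = e j"
      using two_equal_orders[of A e] A by blast
    have "length w = card (insert z A)"
      using distinct_card[OF word(2)] word(3) by simp
    then have "length w = Suc (card A)"
      using A by simp
    then have "word_value (v \<circ> (\<sigma> \<circ> transpose i j)) w = word_value (v \<circ> \<sigma>) w" for \<sigma>
      unfolding o_assoc using word(2) e[of i] e[of j] ij
      by (intro word_value_transpose[where e = "e i"] comm) simp_all
    then show ?case
      using ij A(1) by (intro alternating_sum_eq_0[of A i j]) (simp_all add: comp_def)
  next
    case (add f g)
    then show ?case
      by (simp add: scale_right_distrib sum.distrib)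
  next
    case (diff f g)
    then show ?case
      by (simp add: scale_right_diff_distrib sum_subtractf)
  qed
qed

theorem satisfies_lie_St_bracket:
  fixes scale :: "'k::field_char_0 \<Rightarrow> 'a \<Rightarrow> 'a"
  assumes "vector_space scale" and "4 \<le> n"
    and comm: "\<And>xs ys :: 'a list. mset xs = mset ys \<Longrightarrow> length xs = Suc n
      \<Longrightarrow> nonempty_prod xs = nonempty_prod ys"
  shows "satisfies_lie_St scale bracket (Suc n)"
  unfolding satisfies_lie_St_def
proof (intro allI)
  fix x :: "nat \<Rightarrow> 'a" and z
  \<comment> \<open>The index \<open>0\<close> is free for \<open>z\<close>, and the permutations of \<open>{1..n}\<close> fix it.\<close>
  define v where "v = x(0 := z)"
  let ?f = "\<lambda>v. foldr (\<lambda>i. bracket (v i)) [1..<Suc n] (v 0)"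
  have "lie_St scale bracket (Suc n) x z
      = (\<Sum>\<sigma> | \<sigma> permutes {1..<Suc n}. scale (of_int (sign \<sigma>)) (?f (v \<circ> \<sigma>)))"
    unfolding lie_St_def
  proof (intro sum.cong refl arg_cong2[where f = scale], goal_cases)
    case (1 \<sigma>)
    then have \<sigma>: "\<sigma> permutes {1..<Suc n}" by simp
    then have "v (\<sigma> 0) = z"
      by (simp add: v_def permutes_not_in)
    moreover have "v (\<sigma> i) = x (\<sigma> i)" if "i \<in> set [1..<Suc n]" for i
      using permutes_in_image[OF \<sigma>, of i] that by (auto simp: v_def)
    ultimately show ?case
      by (intro foldr_cong) simp_all
  qed
  also have "\<dots> = 0"
    using multilinear_diff_poly_iterated_bracket[of "[1..<Suc n]" 0] assms
    by (intro alternating_sum_diff_poly_eq_0[where z = 0]) (simp_all del: upt_Suc)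
  finally show "lie_St scale bracket (Suc n) x z = 0" .
qed

end


section \<open>Polynomials over the algebra\<close>

lemma poly_first_commute:
  fixes p q r1 r2 r3 :: "nat \<Rightarrow>\<^sub>0 'a::ring"
  assumes "\<And>x y z1 z2 z3 :: 'a. x * y * z1 * z2 * z3 = y * x * z1 * z2 * z3"
  shows "p * q * r1 * r2 * r3 = q * p * r1 * r2 * r3"
proof (induction p rule: poly_mapping_add_induct)
  case (single k x)
  show ?case
  proof (induction q rule: poly_mapping_add_induct)
    case (single l y)
    show ?case
    proof (induction r1 rule: poly_mapping_add_induct)
      case (single m1 z1)
      show ?case
      proof (induction r2 rule: poly_mapping_add_induct)
        case (single m2 z2)
        show ?case
          by (induction r3 rule: poly_mapping_add_induct)
            (simp_all add: mult_single assms add.commute[of k l] distrib_left)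
      qed (simp_all add: distrib_left distrib_right)
    qed (simp_all add: distrib_left distrib_right)
  qed (simp_all add: distrib_left distrib_right)
qed (simp_all add: distrib_left distrib_right)

theorem proposition6p4:
  fixes scale :: "'k::field_char_0 \<Rightarrow> 'a::ring \<Rightarrow> 'a"
  assumes "assoc_algebra scale"
    and "\<forall>x y z :: 'a. x * (y * z - z * y) = 0"
    and "\<forall>x y z1 z2 z3 :: 'a. (x * y - y * x) * z1 * z2 * z3 = 0"
  shows "satisfies_lie_St (poly_scale scale) (poly_bracket scale) 5"
proof -
  interpret assoc_algebra scale by fact
  interpret poly: assoc_algebra "poly_scale scale"
    by (rule assoc_algebra_poly)
  interpret deriv: ring_derivation "poly_deriv scale"
    by unfold_locales (simp_all add: poly_deriv_add poly_deriv_mult)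
  have right: "p * (q * r) = p * (r * q)" for p q r :: "nat \<Rightarrow>\<^sub>0 'a"
    by (rule poly_right_commute) (use assms(2) in blast)
  have "x * y * z1 * z2 * z3 = y * x * z1 * z2 * z3" for x y z1 z2 z3 :: 'a
    using assms(3)[rule_format, of x y z1 z2 z3] by (simp add: left_diff_distrib)
  note first = poly_first_commute[OF this]
  have "satisfies_lie_St (poly_scale scale) deriv.bracket (Suc 4)"
    using nonempty_prod_cong_mset[OF right first]
    by (intro deriv.satisfies_lie_St_bracket poly.vector_space_axioms) simp_all
  moreover have "deriv.bracket = poly_bracket scale"
    by (simp add: fun_eq_iff deriv.bracket_def poly_bracket_def)
  ultimately show ?thesis
    by simp
qed

end
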